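(* Let $I=[0,1]$ and let $L:\mathbb{R}\times\mathbb{R}\to[0,+\infty[$ be the Lagrangian $$L(y,v)=\begin{cases}\left(v^2-\dfrac{1}{4y^2}\right)^2v^2 & \text{if } y\neq 0,\\ 1 & \text{if } y=0,\end{cases}$$ and let $F(y)=\int_0^1 L(y(t),y'(t))\,dt$ for $y\in W^{1,1}(I)$. Let $y_*(s)=\sqrt{s}$ for $s\in[0,1]$. Then $y_*$ is a minimizer of the problem $$\text{(P)}\qquad \min F(y),\quad y\in W^{1,1}(I),\quad y(0)=0,$$ and moreover $F(y_* )=0$. The Lavrentiev gap for (P) occurs at $y_*$; more precisely, for every Lipschitz function $y:[0,1]\to\mathbb{R}$ with $y(0)=0$ we have $F(y)\ge 1$.
   Context: For $1\le p\le+\infty$, $W^{1,p}(I)$ denotes the space of absolutely continuous functions $y:I\to\mathbb{R}$ with $y'\in L^p(I)$. The integral defining $F$ takes values in $[0,+\infty]$. Let $p\ge 1$ and let $y\in W^{1,p}(I)$ with $F(y)<+\infty$. The Lavrentiev gap does not occur at $y$ for (P) if there is a sequence $(y_h)_{h\in\mathbb{N}}$ of functions on $I$ such that: (1) for each $h$, $y_h$ is Lipschitz and $y_h(0)=0$; (2) $\lim_{h\to+\infty}F(y_h)=F(y)$; (3) $y_h\to y$ in $W^{1,p}(I)$. Otherwise the Lavrentiev gap occurs at $y$. *)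

theory Defs
  imports "HOL-Analysis.Analysis" "HOL-Probability.Essential_Supremum"
begin

text \<open>
  Functions on the interval $[0,1]$ are represented by total functions on the reals; no definition
  below depends on the values outside of $[0,1]$.
\<close>

abbreviation unit_I :: "real set" where
  "unit_I \<equiv> {0..1}"

text \<open>
  The finite families of non-overlapping subintervals may contain degenerate ones, which contribute
  0 to both sums.
\<close>

definition abs_cont :: "(real \<Rightarrow> real) \<Rightarrow> bool" where
  "abs_cont y \<longleftrightarrow>
     (\<forall>\<epsilon>>0. \<exists>\<delta>>0. \<forall>(n::nat) a b.
        (\<forall>i<n. 0 \<le> a i \<and> a i \<le> b i \<and> b i \<le> 1) \<and>
        disjoint_family_on (\<lambda>i. {a i<..<b i}) {..<n} \<and>
        (\<Sum>i<n. b i - a i) < \<delta>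
        \<longrightarrow> (\<Sum>i<n. \<bar>y (b i) - y (a i)\<bar>) < \<epsilon>)"

text \<open>
  The derivative is only meaningful at points of differentiability. An absolutely continuous
  function is differentiable almost everywhere, so that the value at the remaining points is
  irrelevant under the integral.
\<close>

definition wderiv :: "(real \<Rightarrow> real) \<Rightarrow> real \<Rightarrow> real" where
  "wderiv y t = vector_derivative y (at t within unit_I)"

definition Lp_norm :: "ennreal \<Rightarrow> (real \<Rightarrow> real) \<Rightarrow> ennreal" where
  "Lp_norm p f =
     (if p = \<infinity> then esssup (lebesgue_on unit_I) (\<lambda>t. ennreal \<bar>f t\<bar>)
      else let A = (\<integral>\<^sup>+t. ennreal (\<bar>f t\<bar> powr enn2real p) \<partial>lebesgue_on unit_I)
           in if A = \<infinity> then \<infinity> else ennreal (enn2real A powr (1 / enn2real p)))"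

definition Lp :: "ennreal \<Rightarrow> (real \<Rightarrow> real) set" where
  "Lp p = {f. f \<in> borel_measurable (lebesgue_on unit_I) \<and> Lp_norm p f < \<infinity>}"

definition W1 :: "ennreal \<Rightarrow> (real \<Rightarrow> real) set" where
  "W1 p = {y. abs_cont y \<and> wderiv y \<in> Lp p}"

definition W1_norm :: "ennreal \<Rightarrow> (real \<Rightarrow> real) \<Rightarrow> ennreal" where
  "W1_norm p y = Lp_norm p y + Lp_norm p (wderiv y)"

definition lipschitz_I :: "(real \<Rightarrow> real) \<Rightarrow> bool" where
  "lipschitz_I y \<longleftrightarrow> (\<exists>K. K-lipschitz_on unit_I y)"

definition Lagr :: "real \<Rightarrow> real \<Rightarrow> real" where
  "Lagr y v = (if y \<noteq> 0 then (v\<^sup>2 - 1 / (4 * y\<^sup>2))\<^sup>2 * v\<^sup>2 else 1)"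

definition F :: "(real \<Rightarrow> real) \<Rightarrow> ennreal" where
  "F y = (\<integral>\<^sup>+t. ennreal (Lagr (y t) (wderiv y t)) \<partial>lebesgue_on unit_I)"

text \<open>
  The first two conjuncts are the conditions on $y$ under which (non-)occurrence of the gap is
  defined.
\<close>

definition lavrentiev_gap :: "ennreal \<Rightarrow> (real \<Rightarrow> real) \<Rightarrow> bool" where
  "lavrentiev_gap p y \<longleftrightarrow>
     y \<in> W1 p \<and> F y < \<infinity> \<and>
     \<not> (\<exists>Y :: nat \<Rightarrow> real \<Rightarrow> real.
          (\<forall>h. lipschitz_I (Y h) \<and> Y h 0 = 0) \<and>
          (\<lambda>h. F (Y h)) \<longlonglongrightarrow> F y \<and>
          (\<lambda>h. W1_norm p (\<lambda>t. Y h t - y t)) \<longlonglongrightarrow> 0)"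

end

theory Submission
  imports Defs
begin

text \<open>
  If $y$ is Lipschitz with $y(0) = 0$ and $y \<noteq> 0$, let $a$ be the last zero of $y$ before some
  point where $y$ does not vanish. To the right of $a$, $|y'| \<le> K$ while $1/(4y^2)$ is large, so
  $L(y, y') \<ge> (y'/y^2)^2/64 = ((1/y)')^2/64$. As $1/y$ is unbounded near $a$, the integral of $|(1/y)'|$,
  and hence that of its square, diverges: $F(y) = \<infinity>$. For $y = 0$ the exceptional value
  $L(0, v) = 1$ gives $F(y) = 1$. The integration of $(1/y)'$ rests on the almost everywhere
  differentiability of Lipschitz functions, obtained from the Radon-Nikodym theorem and Lebesgue's
  differentiation theorem.
\<close>

section \<open>Lipschitz functions as integrals of their almost everywhere derivatives\<close>

text \<open>
  Adding $(K + 1) x$ makes $f$ a bi-Lipschitz homeomorphism $g$; the measure $A \<mapsto> |g(A)|$ is then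
  absolutely continuous, and its density is the derivative of $g$.
\<close>

lemma lipschitz_UNIV_has_integral:
  fixes f :: "real \<Rightarrow> real"
  assumes "K-lipschitz_on UNIV f"
  obtains f' where "f' \<in> borel_measurable borel"
    "\<And>a b. a \<le> b \<Longrightarrow> (f' has_integral (f b - f a)) {a..b}"
proof -
  have K: "\<bar>f x - f y\<bar> \<le> K * \<bar>x - y\<bar>" for x y
    using lipschitz_onD[OF assms, of x y] by (simp add: dist_real_def)
  have K0: "K \<ge> 0" using assms by (rule lipschitz_on_nonneg)
  define g where "g x = f x + (K + 1) * x" for x
  \<comment> \<open>\<open>f\<close> decreases at rate at most \<open>K\<close>, so the added slope
    \<open>K + 1\<close> leaves a net slope of at least 1.\<close>
  have expand: "g y - g x \<ge> y - x" if "x \<le> y" for x y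
    using K[of y x] that unfolding g_def by (auto simp: algebra_simps abs_le_iff)
  have mono: "g x \<le> g y \<longleftrightarrow> x \<le> y" for x y
    using expand[of x y] expand[of y x] by linarith
  have expand': "\<bar>x - y\<bar> \<le> \<bar>g x - g y\<bar>" for x y
    using expand[of x y] expand[of y x] by linarith
  have glip: "\<bar>g x - g y\<bar> \<le> (2 * K + 1) * \<bar>x - y\<bar>" for x y
  proof -
    have "g x - g y = (f x - f y) + (K + 1) * (x - y)"
      by (simp add: g_def algebra_simps)
    moreover have "\<bar>(K + 1) * (x - y)\<bar> = (K + 1) * \<bar>x - y\<bar>"
      using K0 by (simp add: abs_mult)
    ultimately show ?thesis
      using K[of x y] abs_triangle_ineq[of "f x - f y" "(K + 1) * (x - y)"]
      by (simp only: distrib_right mult_1)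
  qed
  have cont: "continuous_on S g" for S
    unfolding g_def using lipschitz_on_continuous_on[OF assms]
    by (intro continuous_intros) (auto intro: continuous_on_subset)
  have "inj g"
  proof (rule injI)
    show "x = y" if "g x = g y" for x y using expand'[of x y] that by simp
  qed
  moreover have "\<exists>x. g x = y" for y
  proof -
    \<comment> \<open>Since \<open>g\<close> expands distances,
      \<open>g (- r) \<le> g 0 - r \<le> y \<le> g 0 + r \<le> g r\<close>, and the intermediate
      value theorem gives a preimage of \<open>y\<close>.\<close>
    define r where "r = \<bar>y - g 0\<bar>"
    have "g (- r) \<le> y" "y \<le> g r"
      using expand[of "- r" 0] expand[of 0 r] by (auto simp: r_def)
    then show ?thesis
      using IVT'[of g "- r" y r] cont r_def by auto
  qed
  then have "surj g" unfolding surj_def by metis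
  ultimately have "bij g" by (rule bijI)
  define k where "k = inv g"
  have gk [simp]: "g (k y) = y" and kg [simp]: "k (g x) = x" for x y
    using \<open>bij g\<close> by (auto simp: k_def bij_is_surj surj_f_inv_f bij_is_inj)
  have vimage: "k -` A = g ` A" for A
    by (auto intro: rev_image_eqI)
  have "1-lipschitz_on UNIV k"
    by (rule lipschitz_onI) (use expand'[of "k _" "k _"] in \<open>auto simp: dist_real_def\<close>)
  then have [measurable]: "k \<in> borel_measurable borel"
    by (intro borel_measurable_continuous_onI lipschitz_on_continuous_on)
  define M where "M = distr lborel lborel k"
  have M: "emeasure M A = emeasure lborel (g ` A)" if "A \<in> sets borel" for A
    using that by (simp add: M_def emeasure_distr vimage)
  have "absolutely_continuous lborel M"
    unfolding absolutely_continuous_def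
  proof
    fix A :: "real set" assume A: "A \<in> null_sets lborel"
    then have [measurable]: "A \<in> sets borel" by auto
    have "negligible A"
      using A by (simp add: negligible_iff_null_sets null_sets_completion_iff)
    then have "negligible (g ` A)"
      by (rule negligible_locally_Lipschitz_image[rotated])
         (use glip in \<open>auto intro!: exI[of _ UNIV]\<close>)
    moreover have "g ` A \<in> sets lborel"
      unfolding vimage[symmetric] sets_lborel by (rule measurable_sets_borel) measurable
    ultimately have "g ` A \<in> null_sets lborel"
      by (simp add: negligible_iff_null_sets null_sets_completion_iff)
    then show "A \<in> null_sets M"
      using M[of A] by (auto simp: null_sets_def M_def)
  qed
  then obtain D where D [measurable]: "D \<in> borel_measurable borel" and dens: "density lborel D = M"
    using sigma_finite_measure.Radon_Nikodym[OF lborel.sigma_finite_measure_axioms, of M] by (auto simp: M_def)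
  \<comment> \<open>The density \<open>D\<close> may be infinite on a null set, where
    \<open>d\<close> takes the value 0. The finite mass of \<open>M\<close> on each interval makes
    \<open>d\<close> and \<open>D\<close> agree almost everywhere there.\<close>
  define d where "d x = enn2real (D x)" for x
  have [measurable]: "d \<in> borel_measurable borel"
    unfolding d_def by measurable
  have d: "(d has_integral (g b - g a)) {a..b}" if ab: "a \<le> b" for a b
  proof -
    have "x \<in> g ` {a..b} \<longleftrightarrow> x \<in> {g a..g b}" for x
      using mono[of a "k x"] mono[of "k x" b] unfolding vimage[symmetric] by simp
    then have "g ` {a..b} = {g a..g b}" by blast
    then have eq: "(\<integral>\<^sup>+x. D x * indicator {a..b} x \<partial>lborel) = ennreal (g b - g a)"
      using M[of "{a..b}"] mono ab
      by (simp add: dens[symmetric] emeasure_density)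
    then have "AE x in lborel. D x * indicator {a..b} x \<noteq> \<infinity>"
      by (intro nn_integral_PInf_AE) auto
    then have "AE x in lborel. ennreal (d x * indicator {a..b} x) = D x * indicator {a..b} x"
      by eventually_elim
         (auto simp: d_def indicator_def ennreal_enn2real_if)
    then have "(\<integral>\<^sup>+x. ennreal (d x * indicator {a..b} x) \<partial>lborel) = ennreal (g b - g a)"
      using eq by (subst nn_integral_cong_AE) auto
    then have "((\<lambda>x. d x * indicator {a..b} x) has_integral (g b - g a)) UNIV"
      using mono ab by (intro nn_integral_has_integral) (auto simp: d_def)
    moreover have "(\<lambda>x. d x * indicator {a..b} x) = (\<lambda>x. if x \<in> {a..b} then d x else 0)"
      by (auto simp: indicator_def)
    ultimately show ?thesis
      by (simp only: has_integral_restrict_UNIV)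
  qed
  show ?thesis
  proof
    show "(\<lambda>x. d x - (K + 1)) \<in> borel_measurable borel"
      by measurable
    show "((\<lambda>x. d x - (K + 1)) has_integral (f b - f a)) {a..b}" if "a \<le> b" for a b
    proof -
      have "((\<lambda>x. d x - (K + 1)) has_integral (g b - g a - (b - a) * (K + 1))) {a..b}"
        using has_integral_diff[OF d has_integral_const_real[of "K + 1" a b]] that
        by simp
      then show ?thesis by (simp add: g_def algebra_simps)
    qed
  qed
qed

text \<open>Lebesgue's differentiation theorem on the intervals from \<open>x\<close> to
  \<open>x + h\<close>: the averages of \<open>f'\<close> over them are the difference quotients of
  \<open>f\<close>. As the intervals start at \<open>x\<close>, only the right derivative
  results.\<close>

lemma has_integral_imp_right_deriv_AE:
  fixes f f' :: "real \<Rightarrow> real"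
  assumes int: "\<And>a b. a \<le> b \<Longrightarrow> (f' has_integral (f b - f a)) {a..b}"
  obtains N where "negligible N"
    "\<And>x. x \<notin> N \<Longrightarrow> ((\<lambda>h. (f (x + h) - f x) / h) \<longlongrightarrow> f' x) (at_right 0)"
proof -
  have "f' integrable_on cbox a b" for a b
    using int[of a b] by (cases "a \<le> b") auto
  then obtain N where N: "negligible N"
    "\<And>x e. x \<notin> N \<Longrightarrow> 0 < e \<Longrightarrow> \<exists>d>0. \<forall>h. 0 < h \<and> h < d \<longrightarrow>
       norm (integral (cbox x (x + h *\<^sub>R One)) f' /\<^sub>R h ^ DIM(real) - f' x) < e"
    using integrable_ccontinuous_explicit[of f'] by metis
  have "((\<lambda>h. (f (x + h) - f x) / h) \<longlongrightarrow> f' x) (at_right 0)" if "x \<notin> N" for x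
  proof (rule tendstoI)
    fix e :: real assume "e > 0"
    from N(2)[OF that this] obtain d where d: "d > 0"
      "\<And>h. 0 < h \<Longrightarrow> h < d \<Longrightarrow> \<bar>integral {x..x + h} f' / h - f' x\<bar> < e"
      by (auto simp: field_simps)
    have "integral {x..x + h} f' = f (x + h) - f x" if "h > 0" for h
      using int[of x "x + h"] that by (auto simp: has_integral_iff)
    then have "dist ((f (x + h) - f x) / h) (f' x) < e" if "h > 0" "h < d" for h
      using d(2)[OF that] that by (simp add: dist_real_def)
    then show "\<forall>\<^sub>F h in at_right 0. dist ((f (x + h) - f x) / h) (f' x) < e"
      unfolding eventually_at_right_field using d(1) by blast
  qed
  with N(1) show ?thesis by (rule that)
qed

text \<open>The left derivative of \<open>f\<close> at \<open>x\<close> is the right derivative of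
  \<open>\<lambda>x. - f (- x)\<close> at \<open>- x\<close>, so the one-sided result is applied
  twice and the second null set is reflected.\<close>

lemma has_integral_imp_deriv_AE:
  fixes f f' :: "real \<Rightarrow> real"
  assumes int: "\<And>a b. a \<le> b \<Longrightarrow> (f' has_integral (f b - f a)) {a..b}"
  obtains N where "negligible N" "\<And>x. x \<notin> N \<Longrightarrow> (f has_real_derivative f' x) (at x)"
proof -
  obtain N1 where N1: "negligible N1"
    "\<And>x. x \<notin> N1 \<Longrightarrow> ((\<lambda>h. (f (x + h) - f x) / h) \<longlongrightarrow> f' x) (at_right 0)"
    using has_integral_imp_right_deriv_AE[OF int] by blast
  have "((\<lambda>x. f' (- x)) has_integral ((- f (- b)) - (- f (- a)))) {a..b}" if "a \<le> b" for a b
    using int[of "- b" "- a"] that has_integral_reflect_real[where f = f' and a = "- b" and b = "- a"] by simp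
  then obtain N2 where N2: "negligible N2"
    "\<And>x. x \<notin> N2 \<Longrightarrow> ((\<lambda>h. ((- f (- (x + h))) - (- f (- x))) / h) \<longlongrightarrow> f' (- x)) (at_right 0)"
    using has_integral_imp_right_deriv_AE[of "\<lambda>x. f' (- x)" "\<lambda>x. - f (- x)"] by blast
  show ?thesis
  proof
    show "negligible (N1 \<union> uminus ` N2)"
      using N1(1) N2(1) by (auto intro!: negligible_differentiable_image_negligible)
    show "(f has_real_derivative f' x) (at x)" if "x \<notin> N1 \<union> uminus ` N2" for x
    proof -
      have "- x \<notin> N2" using that by force
      from N2(2)[OF this] have "((\<lambda>h. (f (x + - h) - f x) / - h) \<longlongrightarrow> f' x) (at_right 0)"
        by (simp add: minus_divide_left)
      then have "((\<lambda>h. (f (x + h) - f x) / h) \<longlongrightarrow> f' x) (at_left 0)"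
        by (subst at_left_minus) (simp add: filterlim_filtermap)
      with N1(2)[of x] that show ?thesis
        by (simp add: DERIV_def filterlim_split_at)
    qed
  qed
qed

section \<open>Integral comparison and pointwise estimates for Lipschitz functions\<close>

text \<open>The coercion \<open>ennreal\<close> replaces \<open>h\<close> by its positive part,
  which can only increase the integral. This admits integrands of either sign in lower bounds for
  \<open>F\<close>.\<close>

lemma has_integral_le_nn_integral:
  fixes h :: "real \<Rightarrow> real"
  assumes [measurable]: "h \<in> borel_measurable borel" "S \<in> sets borel" and h: "(h has_integral r) S"
  shows "ennreal r \<le> (\<integral>\<^sup>+x. ennreal (h x) * indicator S x \<partial>lborel)"
proof (cases "(\<integral>\<^sup>+x. ennreal (h x) * indicator S x \<partial>lborel)")
  case (real q)
  have "(\<integral>\<^sup>+x. ennreal (max 0 (h x) * indicator S x) \<partial>lborel) = ennreal q"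
    unfolding real(2)[symmetric] by (intro nn_integral_cong) (auto simp: indicator_def max_def ennreal_neg)
  then have "((\<lambda>x. max 0 (h x) * indicator S x) has_integral q) UNIV"
    by (intro nn_integral_has_integral) (use real(1) in auto)
  then have "((\<lambda>x. max 0 (h x)) has_integral q) S"
    by (subst (asm) has_integral_cong[where g = "\<lambda>x. if x \<in> S then max 0 (h x) else 0"])
       (auto simp: has_integral_restrict_UNIV)
  with h have "r \<le> q" by (rule has_integral_le) auto
  then show ?thesis using real by (simp add: ennreal_leI)
qed auto

lemma wderiv_eq:
  assumes "0 < t" "t < 1" "(y has_real_derivative v) (at t)"
  shows "wderiv y t = v"
proof -
  have "(y has_vector_derivative v) (at t within unit_I)"
    using assms(3) by (meson has_real_derivative_iff_has_vector_derivative has_vector_derivative_at_within)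
  then show ?thesis
    unfolding wderiv_def using assms by (intro vector_derivative_within_closed_interval) auto
qed

text \<open>Near a zero of a $K$-Lipschitz $y$ the term $v^2$ is negligible against $1/(4y^2)$.\<close>

lemma Lagr_ge:
  assumes "y \<noteq> 0" "8 * (K * y)\<^sup>2 \<le> 1" "\<bar>v\<bar> \<le> K"
  shows "(v / y\<^sup>2)\<^sup>2 / 64 \<le> Lagr y v"
proof -
  have "v\<^sup>2 \<le> K\<^sup>2"
    using assms(3) abs_le_square_iff[of v K] by linarith
  then have "8 * (v\<^sup>2 * y\<^sup>2) \<le> 8 * (K\<^sup>2 * y\<^sup>2)"
    by (intro mult_left_mono mult_right_mono) auto
  also have "\<dots> \<le> 1" using assms(2) by (simp add: power_mult_distrib)
  finally have "v\<^sup>2 \<le> 1 / (8 * y\<^sup>2)"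
    using assms(1) by (simp add: field_simps)
  then have "1 / (8 * y\<^sup>2) \<le> 1 / (4 * y\<^sup>2) - v\<^sup>2"
    using assms(1) by (simp add: field_simps)
  then have "(1 / (8 * y\<^sup>2))\<^sup>2 \<le> (1 / (4 * y\<^sup>2) - v\<^sup>2)\<^sup>2"
    by (intro power_mono) auto
  then have "(1 / (8 * y\<^sup>2))\<^sup>2 * v\<^sup>2 \<le> (v\<^sup>2 - 1 / (4 * y\<^sup>2))\<^sup>2 * v\<^sup>2"
    by (intro mult_right_mono) (auto simp: power2_commute)
  then show ?thesis
    using assms(1) by (simp add: Lagr_def power_divide power_mult_distrib field_simps)
qed

text \<open>Clamping the argument to \<open>{c..d}\<close> extends \<open>f\<close> to the whole
  line with the same Lipschitz constant; in the open interval the extension and \<open>f\<close>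
  have the same derivatives.\<close>

lemma lipschitz_Icc_has_integral:
  fixes f :: "real \<Rightarrow> real"
  assumes f: "K-lipschitz_on {c..d} f" and "c \<le> d"
  obtains f' N where "f' \<in> borel_measurable borel" "(f' has_integral (f d - f c)) {c..d}"
    "negligible N" "\<And>x. c < x \<Longrightarrow> x < d \<Longrightarrow> x \<notin> N \<Longrightarrow> (f has_real_derivative f' x) (at x)"
proof -
  define g where "g x = f (max c (min d x))" for x
  have "K-lipschitz_on UNIV g"
  proof (rule lipschitz_onI)
    show K0: "K \<ge> 0" using f by (rule lipschitz_on_nonneg)
    fix x y :: real
    have "dist (g x) (g y) \<le> K * dist (max c (min d x)) (max c (min d y))"
      unfolding g_def using \<open>c \<le> d\<close> by (intro lipschitz_onD[OF f]) auto
    also have "\<dots> \<le> K * dist x y"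
      by (intro mult_left_mono K0) (auto simp: dist_real_def max_def min_def)
    finally show "dist (g x) (g y) \<le> K * dist x y" .
  qed
  then obtain f' where f': "f' \<in> borel_measurable borel"
    "\<And>a b. a \<le> b \<Longrightarrow> (f' has_integral (g b - g a)) {a..b}"
    using lipschitz_UNIV_has_integral by blast
  obtain N where N: "negligible N" "\<And>x. x \<notin> N \<Longrightarrow> (g has_real_derivative f' x) (at x)"
    using has_integral_imp_deriv_AE[OF f'(2)] by blast
  show ?thesis
  proof
    show "(f' has_integral (f d - f c)) {c..d}"
      using f'(2)[OF \<open>c \<le> d\<close>] \<open>c \<le> d\<close> by (simp add: g_def)
    show "(f has_real_derivative f' x) (at x)" if "c < x" "x < d" "x \<notin> N" for x
    proof (rule has_field_derivative_transform_within_open[OF N(2)[OF that(3)], of "{c<..<d}"])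
      show "g y = f y" if "y \<in> {c<..<d}" for y using that by (simp add: g_def)
    qed (use that in auto)
  qed (fact f' N)+
qed

lemma lipschitz_deriv_le:
  fixes f :: "real \<Rightarrow> real"
  assumes "K-lipschitz_on S f" "open T" "T \<subseteq> S" "x \<in> T" "(f has_real_derivative D) (at x)"
  shows "\<bar>D\<bar> \<le> K"
proof -
  have "((\<lambda>y. (f y - f x) / (y - x)) \<longlongrightarrow> D) (at x)"
    using assms(5) by (simp add: has_field_derivative_iff)
  then have "((\<lambda>y. \<bar>(f y - f x) / (y - x)\<bar>) \<longlongrightarrow> \<bar>D\<bar>) (at x)"
    by (rule tendsto_rabs)
  moreover have "\<forall>\<^sub>F y in at x. \<bar>(f y - f x) / (y - x)\<bar> \<le> K"
    using eventually_at_in_open[OF assms(2,4)]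
  proof eventually_elim
    case (elim y)
    then have "\<bar>f y - f x\<bar> \<le> K * \<bar>y - x\<bar>"
      using lipschitz_onD[OF assms(1), of y x] assms(3,4) by (auto simp: dist_real_def)
    then show ?case using elim by (simp add: field_simps)
  qed
  ultimately show ?thesis
    by (rule tendsto_upperbound) simp
qed

text \<open>From \<open>|1/u - 1/v| = |u - v| / (|u| |v|)\<close>. It makes \<open>1/y\<close>
  Lipschitz on compact intervals without zeros of \<open>y\<close>.\<close>

lemma lipschitz_on_inverse:
  fixes f :: "'a::metric_space \<Rightarrow> real"
  assumes f: "K-lipschitz_on S f" and m: "0 < m" "\<And>x. x \<in> S \<Longrightarrow> m \<le> \<bar>f x\<bar>"
  shows "(K / m\<^sup>2)-lipschitz_on S (\<lambda>x. inverse (f x))"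
proof (rule lipschitz_onI)
  show "0 \<le> K / m\<^sup>2" using lipschitz_on_nonneg[OF f] by simp
  fix x y assume xy: "x \<in> S" "y \<in> S"
  then have nz: "f x \<noteq> 0" "f y \<noteq> 0" and "m * m \<le> \<bar>f x\<bar> * \<bar>f y\<bar>"
    using m(2)[of x] m(2)[of y] m(1) by (auto intro: mult_mono)
  then have "\<bar>f x - f y\<bar> / (\<bar>f x\<bar> * \<bar>f y\<bar>) \<le> \<bar>f x - f y\<bar> / (m * m)"
    using m(1) by (intro divide_left_mono) auto
  also have "\<dots> \<le> K * dist x y / (m * m)"
    using lipschitz_onD[OF f xy] by (intro divide_right_mono) (auto simp: dist_real_def)
  also have "\<bar>f x - f y\<bar> / (\<bar>f x\<bar> * \<bar>f y\<bar>) = dist (inverse (f x)) (inverse (f y))"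
    using nz by (simp add: dist_real_def inverse_diff_inverse abs_mult field_simps abs_minus_commute)
  finally show "dist (inverse (f x)) (inverse (f y)) \<le> K / m\<^sup>2 * dist x y"
    by (simp add: power2_eq_square)
qed

section \<open>Infinite energy of nonzero Lipschitz functions vanishing at 0\<close>

text \<open>
  With $z = 1/y$ the previous bound reads $L \ge z'^2/64$, and $z'^2 \ge 2 s z' - 1$ for
  $s = \pm 1$ turns the integral into the increment of $z$.
\<close>

lemma F_ge_inverse_increment:
  assumes y: "K-lipschitz_on unit_I y" and cd: "0 \<le> c" "c \<le> d" "d \<le> 1"
    and small: "\<And>t. t \<in> {c..d} \<Longrightarrow> y t \<noteq> 0 \<and> 8 * (K * y t)\<^sup>2 \<le> 1"
  shows "ennreal ((2 * \<bar>inverse (y c) - inverse (y d)\<bar> - 1) / 64) \<le> F y"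
proof -
  define z where "z t = inverse (y t)" for t
  \<comment> \<open>The sign for which \<open>s * (z d - z c)\<close> is the absolute increment of
    \<open>z\<close>.\<close>
  define s :: real where "s = (if z c \<le> z d then 1 else - 1)"
  have ylip: "K-lipschitz_on {c..d} y"
    using y by (rule lipschitz_on_subset) (use cd in auto)
  have "continuous_on {c..d} (\<lambda>t. \<bar>y t\<bar>)"
    by (intro continuous_intros lipschitz_on_continuous_on[OF ylip])
  \<comment> \<open>The minimum of \<open>|y|\<close> on the compact interval is positive and serves
    as the lower bound needed to invert \<open>y\<close>.\<close>
  then obtain t0 where t0: "t0 \<in> {c..d}" "\<And>t. t \<in> {c..d} \<Longrightarrow> \<bar>y t0\<bar> \<le> \<bar>y t\<bar>"
    using continuous_attains_inf[of "{c..d}" "\<lambda>t. \<bar>y t\<bar>"] cd by auto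
  then have "(K / \<bar>y t0\<bar>\<^sup>2)-lipschitz_on {c..d} z"
    unfolding z_def using small by (intro lipschitz_on_inverse[OF ylip]) auto
  then obtain z' N where z': "z' \<in> borel_measurable borel" "(z' has_integral (z d - z c)) {c..d}"
    and N: "negligible N" "\<And>t. c < t \<Longrightarrow> t < d \<Longrightarrow> t \<notin> N \<Longrightarrow> (z has_real_derivative z' t) (at t)"
    using lipschitz_Icc_has_integral[OF _ cd(2)] by metis
  define h where "h t = (2 * s * z' t - 1) / 64" for t
  have [measurable]: "h \<in> borel_measurable borel"
    using z'(1) unfolding h_def by measurable
  have "(h has_integral ((2 * s * (z d - z c) - (d - c)) / 64)) {c..d}"
    unfolding h_def
    using has_integral_diff[OF has_integral_mult_right[OF z'(2), of "2 * s"] has_integral_const_real[of 1 c d]] cd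
    by (intro has_integral_divide) simp
  then have "ennreal ((2 * s * (z d - z c) - (d - c)) / 64) \<le> (\<integral>\<^sup>+t. ennreal (h t) * indicator {c..d} t \<partial>lborel)"
    by (intro has_integral_le_nn_integral) auto
  also have "\<dots> = (\<integral>\<^sup>+t. ennreal (h t) * indicator {c..d} t \<partial>lebesgue)"
    by (simp add: nn_integral_completion)
  also have "\<dots> \<le> (\<integral>\<^sup>+t. ennreal (Lagr (y t) (wderiv y t)) * indicator unit_I t \<partial>lebesgue)"
  proof (rule nn_integral_mono_AE)
    have "negligible (N \<union> {c, d})" using N(1) by (simp add: negligible_Un)
    then have "AE t in lebesgue. t \<notin> N \<union> {c, d}"
      by (intro AE_not_in) (simp add: negligible_iff_null_sets)
    then show "AE t in lebesgue. ennreal (h t) * indicator {c..d} t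
        \<le> ennreal (Lagr (y t) (wderiv y t)) * indicator unit_I t"
    proof eventually_elim
      case (elim t)
      show ?case
      proof (cases "t \<in> {c..d}")
        case True
        with elim have t: "c < t" "t < d" "t \<notin> N" by auto
        have nz: "y t \<noteq> 0" using small True by blast
        \<comment> \<open>The derivative of \<open>y\<close> is recovered from that of
          \<open>z\<close> through \<open>y = 1/z\<close>. It equals \<open>- z' y^2\<close>, so the
          quotient \<open>v / y^2\<close> in \<open>Lagr_ge\<close> is \<open>- z'\<close>.\<close>
        have "((\<lambda>t. inverse (z t)) has_real_derivative - (inverse (z t) * z' t * inverse (z t))) (at t)"
          by (rule DERIV_inverse'[OF N(2)[OF t]]) (use nz in \<open>simp add: z_def\<close>)
        then have D: "(y has_real_derivative - (z' t * (y t)\<^sup>2)) (at t)"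
          by (simp add: z_def power2_eq_square mult_ac)
        have w: "wderiv y t = - (z' t * (y t)\<^sup>2)"
          by (rule wderiv_eq[OF _ _ D]) (use t cd in auto)
        have "\<bar>- (z' t * (y t)\<^sup>2)\<bar> \<le> K"
          by (rule lipschitz_deriv_le[OF ylip _ _ _ D, of "{c<..<d}"]) (use t in auto)
        then have "(- (z' t * (y t)\<^sup>2) / (y t)\<^sup>2)\<^sup>2 / 64 \<le> Lagr (y t) (wderiv y t)"
          unfolding w using small[OF True] by (intro Lagr_ge) auto
        then have "(z' t)\<^sup>2 / 64 \<le> Lagr (y t) (wderiv y t)"
          using nz by simp
        moreover have "0 \<le> (s * z' t - 1)\<^sup>2" by simp
        then have "2 * s * z' t - 1 \<le> (z' t)\<^sup>2"
          by (auto simp: s_def power2_diff power_mult_distrib algebra_simps split: if_splits)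
        ultimately have "h t \<le> Lagr (y t) (wderiv y t)"
          by (simp add: h_def)
        then show ?thesis
          using True cd by (auto simp: ennreal_leI)
      qed simp
    qed
  qed
  also have "\<dots> = F y"
    by (simp add: F_def nn_integral_restrict_space)
  finally have "ennreal ((2 * s * (z d - z c) - (d - c)) / 64) \<le> F y" .
  \<comment> \<open>The \<open>- 1\<close> absorbs \<open>d - c \<le> 1\<close>.\<close>
  moreover have "2 * \<bar>z c - z d\<bar> - 1 \<le> 2 * s * (z d - z c) - (d - c)"
    using cd by (auto simp: s_def)
  then have "ennreal ((2 * \<bar>z c - z d\<bar> - 1) / 64) \<le> ennreal ((2 * s * (z d - z c) - (d - c)) / 64)"
    by (intro ennreal_leI divide_right_mono) auto
  ultimately show ?thesis
    unfolding z_def by (rule order_trans[rotated])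
qed

text \<open>The increment bound is applied on \<open>{c..d}\<close> with \<open>d\<close> fixed and
  \<open>c\<close> approaching the last zero \<open>a\<close> before \<open>t1\<close>:
  \<open>1/y\<close> is unbounded near \<open>a\<close>, so \<open>F y\<close> exceeds every
  real.\<close>

lemma F_lipschitz_eq_infinity:
  assumes y: "K-lipschitz_on unit_I y" "y 0 = 0" and t1: "t1 \<in> unit_I" "y t1 \<noteq> 0"
  shows "F y = \<infinity>"
proof -
  have K0: "K \<ge> 0" using y(1) by (rule lipschitz_on_nonneg)
  have cont: "continuous_on {0..t1} y"
    by (rule continuous_on_subset[OF lipschitz_on_continuous_on[OF y(1)]]) (use t1 in auto)
  define Z where "Z = {t \<in> {0..t1}. y t = 0}"
  have "compact Z"
    unfolding compact_eq_bounded_closed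
  proof
    show "bounded Z" by (rule bounded_subset[of "{0..t1}"]) (auto simp: Z_def)
    show "closed Z" unfolding Z_def using cont by (rule continuous_closed_preimage_constant) simp
  qed
  moreover have "0 \<in> Z" using t1 y by (auto simp: Z_def)
  ultimately obtain a where a: "a \<in> Z" "\<And>t. t \<in> Z \<Longrightarrow> t \<le> a"
    using compact_attains_sup[of Z] by auto
  have "a < t1" "0 \<le> a" "y a = 0"
    using a(1) t1 by (auto simp: Z_def less_le)
  have nz: "y t \<noteq> 0" if "a < t" "t \<le> t1" for t
    using a(2)[of t] that \<open>0 \<le> a\<close> by (auto simp: Z_def)
  have ybd: "\<bar>y t\<bar> \<le> K * (t - a)" if "a \<le> t" "t \<le> t1" for t
    using lipschitz_onD[OF y(1), of t a] that \<open>0 \<le> a\<close> \<open>y a = 0\<close> t1 by (auto simp: dist_real_def)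
  \<comment> \<open>Up to this point \<open>|K y| \<le> K^2 (t - a) \<le> 1/3\<close>, and
    \<open>8/9 \<le> 1\<close> gives the smallness condition.\<close>
  define d where "d = min t1 (a + 1 / (3 * (K\<^sup>2 + 1)))"
  have "a < d" using \<open>a < t1\<close> by (simp add: d_def add_nonneg_pos)
  have small: "8 * (K * y t)\<^sup>2 \<le> 1" if "a \<le> t" "t \<le> d" for t
  proof -
    have "\<bar>K * y t\<bar> \<le> K * (K * (t - a))"
      using ybd[of t] that K0 by (auto simp: d_def abs_mult intro!: mult_left_mono)
    also have "\<dots> = K\<^sup>2 * (t - a)" by (simp add: power2_eq_square)
    also have "\<dots> \<le> K\<^sup>2 * (1 / (3 * (K\<^sup>2 + 1)))"
      using that by (intro mult_left_mono) (auto simp: d_def)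
    also have "\<dots> \<le> 1 / 3" by (simp add: field_simps add_pos_nonneg)
    finally have "(K * y t)\<^sup>2 \<le> (1 / 3)\<^sup>2"
      by (simp add: abs_le_square_iff[symmetric])
    then show ?thesis by (simp add: power2_eq_square)
  qed
  have bound: "ennreal r \<le> F y" for r
  proof -
    \<comment> \<open>Large enough that \<open>R \<le> |1/y(c)|\<close> lifts the increment bound to
      at least \<open>r\<close>, after the losses from \<open>1/y(d)\<close> and the factor
      64.\<close>
    define R where "R = \<bar>64 * r\<bar> + 1 + 2 * \<bar>inverse (y d)\<bar>"
    \<comment> \<open>So close to \<open>a\<close> that
      \<open>|y c| \<le> K (c - a) \<le> 1/R\<close>; \<open>K + 1\<close> instead of
      \<open>K\<close> keeps the denominator positive.\<close>
    define c where "c = min d (a + 1 / ((K + 1) * R))"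
    have "R > 0" unfolding R_def by linarith
    have c: "a < c" "c \<le> d" using \<open>a < d\<close> \<open>R > 0\<close> K0 by (auto simp: c_def)
    have "y c \<noteq> 0" by (rule nz) (use c in \<open>auto simp: d_def\<close>)
    have "\<bar>y c\<bar> \<le> K * (c - a)" by (rule ybd) (use c in \<open>auto simp: d_def\<close>)
    also have "\<dots> \<le> K * (1 / ((K + 1) * R))"
      by (intro mult_left_mono) (auto simp: c_def K0)
    also have "\<dots> = K / (K + 1) * (1 / R)" by simp
    also have "\<dots> \<le> 1 * (1 / R)"
      using K0 \<open>R > 0\<close> by (intro mult_right_mono) auto
    finally have "R * \<bar>y c\<bar> \<le> 1"
      using \<open>R > 0\<close> by (simp add: field_simps)
    then have "R \<le> \<bar>inverse (y c)\<bar>"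
      using \<open>y c \<noteq> 0\<close> by (simp add: field_simps)
    moreover have "64 * r + 1 + 2 * \<bar>inverse (y d)\<bar> \<le> R"
      unfolding R_def by linarith
    moreover have "\<bar>inverse (y c)\<bar> - \<bar>inverse (y d)\<bar> \<le> \<bar>inverse (y c) - inverse (y d)\<bar>"
      by (rule abs_triangle_ineq2)
    ultimately have "r \<le> (2 * \<bar>inverse (y c) - inverse (y d)\<bar> - 1) / 64"
      by argo
    then have "ennreal r \<le> ennreal ((2 * \<bar>inverse (y c) - inverse (y d)\<bar> - 1) / 64)"
      by (rule ennreal_leI)
    also have "\<dots> \<le> F y"
      by (rule F_ge_inverse_increment[OF y(1)])
         (use c nz small \<open>0 \<le> a\<close> t1 in \<open>auto simp: d_def\<close>)
    finally show ?thesis .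
  qed
  show ?thesis
  proof (cases "F y")
    case (real r)
    then show ?thesis using bound[of "r + 1"] by simp
  qed simp
qed

lemma F_lipschitz_ge_1:
  assumes "lipschitz_I y" "y 0 = 0"
  shows "1 \<le> F y"
proof (cases "\<exists>t\<in>unit_I. y t \<noteq> 0")
  case True
  then show ?thesis
    using assms F_lipschitz_eq_infinity unfolding lipschitz_I_def by (metis top_greatest infinity_ennreal_def)
next
  case False
  then have "F y = (\<integral>\<^sup>+t. 1 \<partial>lebesgue_on unit_I)"
    unfolding F_def by (intro nn_integral_cong) (auto simp: Lagr_def)
  then show ?thesis
    by (simp add: emeasure_restrict_space)
qed

section \<open>The square root: absolute continuity, zero energy, integrable derivative\<close>

text \<open>Additivity and monotonicity of Lebesgue measure; it will bound the total increment of
  the square root near 0 through the disjoint image intervals.\<close>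

lemma sum_disjoint_intervals_le:
  fixes a b :: "'i \<Rightarrow> real"
  assumes "finite S" "\<And>i. i \<in> S \<Longrightarrow> A \<le> a i \<and> a i \<le> b i \<and> b i \<le> B"
    and disj: "disjoint_family_on (\<lambda>i. {a i<..<b i}) S" and "A \<le> B"
  shows "(\<Sum>i\<in>S. b i - a i) \<le> B - A"
proof -
  have "(\<Sum>i\<in>S. b i - a i) = (\<Sum>i\<in>S. measure lborel {a i<..<b i})"
    using assms(2) by (intro sum.cong) auto
  also have "\<dots> = measure lborel (\<Union>i\<in>S. {a i<..<b i})"
    using assms(1,2) disj by (intro measure_finite_Union[symmetric]) auto
  also have "\<dots> \<le> measure lborel {A..B}"
    using assms by (intro measure_mono_fmeasurable) (force simp: fmeasurable_def)+
  finally show ?thesis using \<open>A \<le> B\<close> by simp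
qed

lemma sqrt_diff_le:
  assumes "0 < \<eta>" "\<eta> \<le> a" "a \<le> b"
  shows "sqrt b - sqrt a \<le> (b - a) / (2 * sqrt \<eta>)"
proof -
  have "(sqrt b - sqrt a) * (2 * sqrt \<eta>) \<le> (sqrt b - sqrt a) * (sqrt b + sqrt a)"
    using assms real_sqrt_le_mono[of \<eta> a] real_sqrt_le_mono[of a b]
    by (intro mult_left_mono) linarith+
  also have "\<dots> = b - a" using assms by (simp add: algebra_simps)
  finally show ?thesis using assms by (simp add: field_simps)
qed

text \<open>The square root is split at a level \<open>\<eta>\<close>. Below it, monotonicity bounds
  all increments together by \<open>sqrt \<eta>\<close>, which is \<open>\<epsilon> / 2\<close>;
  above it, the function is Lipschitz with constant \<open>1 / (2 * sqrt \<eta>)\<close>, which is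
  \<open>1 / \<epsilon>\<close>.\<close>

lemma abs_cont_sqrt: "abs_cont sqrt"
  unfolding abs_cont_def
proof (intro allI impI)
  fix \<epsilon> :: real assume "\<epsilon> > 0"
  define \<eta> where "\<eta> = (\<epsilon> / 2)\<^sup>2"
  have sq: "sqrt \<eta> = \<epsilon> / 2" and "\<eta> > 0" using \<open>\<epsilon> > 0\<close> by (auto simp: \<eta>_def real_sqrt_abs)
  show "\<exists>\<delta>>0. \<forall>(n::nat) a b. (\<forall>i<n. 0 \<le> a i \<and> a i \<le> b i \<and> b i \<le> 1) \<and>
        disjoint_family_on (\<lambda>i. {a i<..<b i}) {..<n} \<and> (\<Sum>i<n. b i - a i) < \<delta>
        \<longrightarrow> (\<Sum>i<n. \<bar>sqrt (b i) - sqrt (a i)\<bar>) < \<epsilon>"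
  \<comment> \<open>Total length below this \<open>\<delta>\<close> makes the Lipschitz part
    contribute less than \<open>\<delta> / \<epsilon> = \<epsilon> / 2\<close>.\<close>
  proof (intro exI[of _ "\<epsilon>\<^sup>2 / 2"] conjI allI impI; (elim conjE)?)
    show "0 < \<epsilon>\<^sup>2 / 2" using \<open>\<epsilon> > 0\<close> by simp
    fix n :: nat and a b :: "nat \<Rightarrow> real"
    assume ab: "\<forall>i<n. 0 \<le> a i \<and> a i \<le> b i \<and> b i \<le> 1"
      and disj: "disjoint_family_on (\<lambda>i. {a i<..<b i}) {..<n}"
      and len: "(\<Sum>i<n. b i - a i) < \<epsilon>\<^sup>2 / 2"
    have "(\<Sum>i<n. sqrt (min \<eta> (b i)) - sqrt (min \<eta> (a i))) \<le> sqrt \<eta> - 0"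
    proof (rule sum_disjoint_intervals_le)
      \<comment> \<open>A point strictly below \<open>sqrt (min \<eta> (b i))\<close> has its square
        below \<open>\<eta>\<close>, so the truncation is inactive there and disjointness carries
        over from the original intervals.\<close>
      have sub: "{sqrt (min \<eta> (a i))<..<sqrt (min \<eta> (b i))} \<subseteq> sqrt ` {a i<..<b i}" if "i < n" for i
      proof
        fix x assume x: "x \<in> {sqrt (min \<eta> (a i))<..<sqrt (min \<eta> (b i))}"
        moreover have "0 \<le> sqrt (min \<eta> (a i))" using ab that \<open>\<eta> > 0\<close> by auto
        ultimately have "0 \<le> x" unfolding greaterThanLessThan_iff by linarith
        then have eq: "x = sqrt (x\<^sup>2)" by simp
        have "sqrt (min \<eta> (a i)) < sqrt (x\<^sup>2)" "sqrt (x\<^sup>2) < sqrt (min \<eta> (b i))"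
          using x eq by auto
        then have "x\<^sup>2 \<in> {a i<..<b i}"
          unfolding real_sqrt_less_iff by auto
        with eq show "x \<in> sqrt ` {a i<..<b i}" by (rule image_eqI)
      qed
      show "disjoint_family_on (\<lambda>i. {sqrt (min \<eta> (a i))<..<sqrt (min \<eta> (b i))}) {..<n}"
        unfolding disjoint_family_on_def
      proof (intro ballI impI)
        fix i j assume "i \<in> {..<n}" "j \<in> {..<n}" "i \<noteq> j"
        then have "{a i<..<b i} \<inter> {a j<..<b j} = {}"
          using disj by (auto simp: disjoint_family_on_def)
        with \<open>i \<in> {..<n}\<close> \<open>j \<in> {..<n}\<close>
        show "{sqrt (min \<eta> (a i))<..<sqrt (min \<eta> (b i))} \<inter> {sqrt (min \<eta> (a j))<..<sqrt (min \<eta> (b j))} = {}"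
          using sub[of i] sub[of j] by (fastforce simp: disjoint_iff)
      qed
    qed (use ab \<open>\<eta> > 0\<close> in \<open>auto intro!: min.mono\<close>)
    moreover have "sqrt (max \<eta> (b i)) - sqrt (max \<eta> (a i)) \<le> (b i - a i) / \<epsilon>" if "i < n" for i
    proof -
      have "sqrt (max \<eta> (b i)) - sqrt (max \<eta> (a i)) \<le> (max \<eta> (b i) - max \<eta> (a i)) / \<epsilon>"
        using sqrt_diff_le[of \<eta> "max \<eta> (a i)" "max \<eta> (b i)"] ab that \<open>\<eta> > 0\<close> sq by (auto simp: max_def)
      also have "\<dots> \<le> (b i - a i) / \<epsilon>"
        using ab that \<open>\<epsilon> > 0\<close> by (intro divide_right_mono) auto
      finally show ?thesis .
    qed
    then have "(\<Sum>i<n. sqrt (max \<eta> (b i)) - sqrt (max \<eta> (a i))) \<le> (\<Sum>i<n. (b i - a i) / \<epsilon>)"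
      by (intro sum_mono) auto
    moreover have "(\<Sum>i<n. (b i - a i) / \<epsilon>) < \<epsilon> / 2"
      using len \<open>\<epsilon> > 0\<close> by (simp add: sum_divide_distrib[symmetric] field_simps power2_eq_square)
    \<comment> \<open>Termwise from \<open>sqrt u = sqrt (min \<eta> u) + sqrt (max \<eta> u) - sqrt
      \<eta>\<close>; the constant cancels in differences.\<close>
    moreover have "(\<Sum>i<n. \<bar>sqrt (b i) - sqrt (a i)\<bar>) =
        (\<Sum>i<n. sqrt (min \<eta> (b i)) - sqrt (min \<eta> (a i))) + (\<Sum>i<n. sqrt (max \<eta> (b i)) - sqrt (max \<eta> (a i)))"
      unfolding sum.distrib[symmetric] using ab
      by (intro sum.cong) (auto simp: min_def max_def)
    ultimately show "(\<Sum>i<n. \<bar>sqrt (b i) - sqrt (a i)\<bar>) < \<epsilon>"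
      using sq by linarith
  qed
qed

lemma wderiv_sqrt: "0 < t \<Longrightarrow> t < 1 \<Longrightarrow> wderiv sqrt t = 1 / (2 * sqrt t)"
  by (rule wderiv_eq) (auto intro!: derivative_eq_intros simp: field_simps)

lemma AE_wderiv_sqrt: "AE t in lebesgue_on unit_I. 0 < t \<and> wderiv sqrt t = 1 / (2 * sqrt t)"
proof -
  have "AE t in lebesgue. t \<notin> {0, 1::real}"
    by (intro AE_not_in) (simp add: negligible_iff_null_sets[symmetric])
  then have "AE t in lebesgue. t \<in> unit_I \<longrightarrow> 0 < t \<and> wderiv sqrt t = 1 / (2 * sqrt t)"
    by eventually_elim (auto simp: wderiv_sqrt)
  then show ?thesis by (subst AE_restrict_space_iff) auto
qed

text \<open>Almost everywhere \<open>v^2 = 1/(4t) = 1/(4 y^2)\<close>, so the squared factor of the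
  Lagrangian vanishes.\<close>

lemma F_sqrt: "F sqrt = 0"
proof -
  have "F sqrt = (\<integral>\<^sup>+t. 0 \<partial>lebesgue_on unit_I)"
    unfolding F_def
  proof (rule nn_integral_cong_AE)
    show "AE t in lebesgue_on unit_I. ennreal (Lagr (sqrt t) (wderiv sqrt t)) = 0"
      using AE_wderiv_sqrt
      by eventually_elim (auto simp: Lagr_def power_divide power_mult_distrib)
  qed
  then show ?thesis by simp
qed

lemma wderiv_sqrt_integral: "(\<integral>\<^sup>+t. ennreal \<bar>wderiv sqrt t\<bar> \<partial>lebesgue_on unit_I) = 1"
proof -
  have "((\<lambda>t. 1 / (2 * sqrt t)) has_integral (sqrt 1 - sqrt 0)) {0..1}"
  \<comment> \<open>The derivative blows up at 0; continuity on the closed interval and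
    differentiability in its interior suffice.\<close>
  proof (rule fundamental_theorem_of_calculus_interior)
    show "(sqrt has_vector_derivative 1 / (2 * sqrt t)) (at t)" if "t \<in> {0<..<1}" for t
      using that unfolding has_real_derivative_iff_has_vector_derivative[symmetric]
      by (auto intro!: derivative_eq_intros simp: field_simps)
  qed (auto intro!: continuous_intros)
  then have "(\<integral>\<^sup>+t. ennreal (1 / (2 * sqrt t)) * indicator {0..1} t \<partial>lborel) = 1"
    by (subst nn_integral_has_integral_lebesgue'[where I = 1]) auto
  then have "(\<integral>\<^sup>+t. ennreal (1 / (2 * sqrt t)) \<partial>lebesgue_on unit_I) = 1"
    by (simp add: nn_integral_restrict_space nn_integral_completion)
  moreover have "(\<integral>\<^sup>+t. ennreal \<bar>wderiv sqrt t\<bar> \<partial>lebesgue_on unit_I) = (\<integral>\<^sup>+t. ennreal (1 / (2 * sqrt t)) \<partial>lebesgue_on unit_I)"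
    by (intro nn_integral_cong_AE, use AE_wderiv_sqrt in eventually_elim) auto
  ultimately show ?thesis by simp
qed

lemma sqrt_in_W1: "sqrt \<in> W1 1"
proof -
  have "wderiv sqrt \<in> borel_measurable (lebesgue_on unit_I)"
  proof (subst measurable_cong)
    \<comment> \<open>The endpoint values of \<open>wderiv sqrt\<close> are kept as constants, since
      the formula is established only in the interior.\<close>
    show "wderiv sqrt t = (if t = 0 then wderiv sqrt 0 else if t = 1 then wderiv sqrt 1 else 1 / (2 * sqrt t))"
      if "t \<in> space (lebesgue_on unit_I)" for t
      using that by (auto simp: wderiv_sqrt)
    show "(\<lambda>t. if t = 0 then wderiv sqrt 0 else if t = 1 then wderiv sqrt 1 else 1 / (2 * sqrt t))
        \<in> borel_measurable (lebesgue_on unit_I)"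
      by (intro measurable_restrict_space1 measurable_completion) measurable
  qed
  moreover have "Lp_norm 1 (wderiv sqrt) < \<infinity>"
    using wderiv_sqrt_integral by (simp add: Lp_norm_def Let_def powr_one)
  ultimately show ?thesis
    by (simp add: W1_def Lp_def abs_cont_sqrt)
qed

theorem proposition3p1:
  shows "is_arg_min F (\<lambda>y. y \<in> W1 1 \<and> y 0 = 0) sqrt \<and>
    F sqrt = 0 \<and>
    (\<forall>p. 1 \<le> p \<and> sqrt \<in> W1 p \<longrightarrow> lavrentiev_gap p sqrt) \<and>
    (\<forall>y. lipschitz_I y \<and> y 0 = 0 \<longrightarrow> 1 \<le> F y)"
proof (intro conjI allI impI)
  show "is_arg_min F (\<lambda>y. y \<in> W1 1 \<and> y 0 = 0) sqrt"
    by (simp add: is_arg_min_def F_sqrt sqrt_in_W1)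
  show "F sqrt = 0" by (rule F_sqrt)
  show "1 \<le> F y" if "lipschitz_I y \<and> y 0 = 0" for y
    using that F_lipschitz_ge_1 by blast
  show "lavrentiev_gap p sqrt" if "1 \<le> p \<and> sqrt \<in> W1 p" for p
    unfolding lavrentiev_gap_def
  proof (intro conjI notI)
    assume "\<exists>Y. (\<forall>h. lipschitz_I (Y h) \<and> Y h 0 = 0) \<and> (\<lambda>h. F (Y h)) \<longlonglongrightarrow> F sqrt \<and>
      (\<lambda>h. W1_norm p (\<lambda>t. Y h t - sqrt t)) \<longlonglongrightarrow> 0"
    then obtain Y :: "nat \<Rightarrow> real \<Rightarrow> real" where Y: "\<And>h. lipschitz_I (Y h) \<and> Y h 0 = 0"
      and lim: "(\<lambda>h. F (Y h)) \<longlonglongrightarrow> F sqrt"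
      by blast
    \<comment> \<open>Energies of at least 1 cannot converge to the value 0.\<close>
    have "1 \<le> F sqrt"
      by (rule LIMSEQ_le_const[OF lim]) (use Y F_lipschitz_ge_1 in blast)
    then show False by (simp add: F_sqrt)
  qed (use that F_sqrt in auto)
qed

end
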